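(* Let $v=q_1q_2\cdots q_s$ be the factorization of $v\ge2$ into powers of distinct primes, and let $k=\min\{q_i:1\le i\le s\}$. Let $t,d$ be positive integers with $q_i>t+1$ for all $i$ and $d+1\le v$. Then an optimum $(d,t)$-CDA$((d+1)v^t;k+t-1,v)$ exists.
   Context: Consecutive $t$-way interaction in an $N\times k$ array $A=(a_{ij})$ over a $v$-set $V$: $T=\{(i,x_i),\dots,(i+t-1,x_{i+t-1})\}$, $1\le i\le k-t+1$, $x_r\in V$; $\rho(A,T)=\{r: a_{r,j}=x_j\ \forall (j,x_j)\in T\}$, $\rho(A,\mathcal T)=\bigcup_{T\in\mathcal T}\rho(A,T)$. A $(d,t)$-CDA$(N;k,v)$ is an $N\times k$ array over $V$ in which every $t$ consecutive columns contain every $t$-tuple at least once, and such that for every set $\mathcal T$ of exactly $d$ distinct consecutive $t$-way interactions and every consecutive $t$-way interaction $T$: $\rho(A,T)\subseteq\rho(A,\mathcal T)$ iff $T\in\mathcal T$. It is optimum if $N=(d+1)v^t$. *)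

theory Defs
  imports "HOL-Computational_Algebra.Primes"
begin

text \<open>An N x k array over the v-set {0..<v} is a function A :: nat => nat => nat,
  with A r c the entry in row r < N and column c < k (0-indexed).\<close>

definition is_array :: "nat \<Rightarrow> nat \<Rightarrow> nat \<Rightarrow> (nat \<Rightarrow> nat \<Rightarrow> nat) \<Rightarrow> bool" where
  "is_array N k v A \<longleftrightarrow> (\<forall>r<N. \<forall>c<k. A r c < v)"

text \<open>A consecutive t-way interaction is encoded as a pair (i, xs): starting column i
  (0-indexed, i + t <= k) and the list xs of length t of symbols placed in columns i, ..., i+t-1.\<close>

definition consec_interactions :: "nat \<Rightarrow> nat \<Rightarrow> nat \<Rightarrow> (nat \<times> nat list) set" where
  "consec_interactions k t v =
     {(i, xs). i + t \<le> k \<and> length xs = t \<and> set xs \<subseteq> {0..<v}}"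

definition rho :: "nat \<Rightarrow> (nat \<Rightarrow> nat \<Rightarrow> nat) \<Rightarrow> nat \<times> nat list \<Rightarrow> nat set" where
  "rho N A T = {r. r < N \<and> (\<forall>j<length (snd T). A r (fst T + j) = snd T ! j)}"

definition rho_set :: "nat \<Rightarrow> (nat \<Rightarrow> nat \<Rightarrow> nat) \<Rightarrow> (nat \<times> nat list) set \<Rightarrow> nat set" where
  "rho_set N A \<T> = (\<Union>T\<in>\<T>. rho N A T)"

definition is_CDA :: "nat \<Rightarrow> nat \<Rightarrow> nat \<Rightarrow> nat \<Rightarrow> nat \<Rightarrow> (nat \<Rightarrow> nat \<Rightarrow> nat) \<Rightarrow> bool" where
  "is_CDA d t N k v A \<longleftrightarrow>
     is_array N k v A \<and>
     (\<forall>T\<in>consec_interactions k t v. rho N A T \<noteq> {}) \<and>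
     (\<forall>\<T> T. \<T> \<subseteq> consec_interactions k t v \<and> card \<T> = d \<and>
             T \<in> consec_interactions k t v \<longrightarrow>
             (rho N A T \<subseteq> rho_set N A \<T> \<longleftrightarrow> T \<in> \<T>))"

definition optimum_CDA_exists :: "nat \<Rightarrow> nat \<Rightarrow> nat \<Rightarrow> nat \<Rightarrow> bool" where
  "optimum_CDA_exists d t k v \<longleftrightarrow> (\<exists>A. is_CDA d t ((d + 1) * v ^ t) k v A)"

end

theory Submission
  imports Defs "HOL-Number_Theory.Residues" "HOL-Algebra.Algebraic_Closure"
begin

text \<open>Index the rows by pairs \<open>(y, zs)\<close> with \<open>y \<le> d\<close> and \<open>zs\<close> a word of length \<open>t\<close>, and put
  \<open>f (c div t) (zs ! (c mod t)) y\<close> in column \<open>c\<close>, where \<open>f 0, \<dots>, f (k - 1)\<close> are \<open>k\<close> maps in two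
  variables over the \<open>v\<close> symbols, bijective in the first variable and pairwise jointly injective.
  A window of \<open>t\<close> consecutive columns involves each letter of \<open>zs\<close> once, so for every \<open>y\<close> exactly
  one row contains a given interaction: each interaction lies in \<open>d + 1\<close> rows. Two distinct windows
  involve some letter through two different \<open>f m\<close>, so two distinct interactions share at most one
  row, and \<open>d\<close> other interactions cannot cover the \<open>d + 1\<close> rows of a given one. The maps are
  \<open>x + m y\<close> over the field of order \<open>q\<^sub>i\<close>, combined over the prime powers \<open>q\<^sub>i\<close> by MacNeish's product.
  The field of order \<open>p ^ e\<close> consists of the roots of \<open>X ^ (p ^ e) - X\<close> in an algebraic closure
  of the integers modulo \<open>p\<close>.\<close>

section \<open>Finite fields\<close>

text \<open>Multiplying the sum for \<open>n\<close> by \<open>x\<close> and by \<open>y\<close> and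
  merging the results is Pascal's rule. The coefficients are repeated additions, so this makes sense
  in every commutative ring.\<close>

lemma (in cring) binomial_expansion:
  assumes x: "x \<in> carrier R" and y: "y \<in> carrier R"
  shows "(x \<oplus> y) [^] (n::nat) = (\<Oplus>k\<in>{..n}. [(n choose k)] \<cdot> (x [^] k \<otimes> y [^] (n - k)))"
proof (induction n)
  case 0
  show ?case using x y by simp
next
  case (Suc n)
  let ?t = "\<lambda>n k. [(n choose k)] \<cdot> (x [^] k \<otimes> y [^] (n - k))"
  have "(x \<oplus> y) [^] Suc n = (\<Oplus>k\<in>{..n}. ?t n k) \<otimes> x \<oplus> (\<Oplus>k\<in>{..n}. ?t n k) \<otimes> y"
    using x y Suc by (simp add: r_distr)
  also have "(\<Oplus>k\<in>{..n}. ?t n k) \<otimes> x = (\<Oplus>k\<in>{..n}. [(n choose k)] \<cdot> (x [^] Suc k \<otimes> y [^] (n - k)))"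
    using x y by (subst finsum_ldistr)
      (auto intro!: finsum_cong' simp: add_pow_ldistr add_pow_rdistr m_ac)
  also have "(\<Oplus>k\<in>{..n}. ?t n k) \<otimes> y = (\<Oplus>k\<in>{..n}. [(n choose k)] \<cdot> (x [^] k \<otimes> y [^] (Suc n - k)))"
    using x y by (subst finsum_ldistr)
      (auto intro!: finsum_cong' simp: add_pow_ldistr m_assoc Suc_diff_le)
  \<comment> \<open>The new top term has coefficient \<open>n choose Suc n = 0\<close>. With it in
    place, splitting off \<open>k = 0\<close> leaves a sum over the same monomials as the sum from
    the factor \<open>x\<close>.\<close>
  also have "\<dots> = (\<Oplus>k\<in>{..Suc n}. [(n choose k)] \<cdot> (x [^] k \<otimes> y [^] (Suc n - k)))"
    using x y by (subst finsum_Suc) (auto simp: binomial_eq_0)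
  also have "\<dots> = (\<Oplus>k\<in>{..n}. [(n choose Suc k)] \<cdot> (x [^] Suc k \<otimes> y [^] (n - k))) \<oplus> y [^] Suc n"
    using x y by (subst finsum_Suc2) auto
  also have "(\<Oplus>k\<in>{..n}. [(n choose k)] \<cdot> (x [^] Suc k \<otimes> y [^] (n - k))) \<oplus> \<dots>
      = (\<Oplus>k\<in>{..n}. [(Suc n choose Suc k)] \<cdot> (x [^] Suc k \<otimes> y [^] (n - k))) \<oplus> y [^] Suc n"
    using x y by (subst a_assoc[symmetric]) 
      (auto simp: add.nat_pow_mult[symmetric] simp del: nat_pow_Suc intro!: finsum_closed)
  also have "\<dots> = (\<Oplus>k\<in>{..Suc n}. ?t (Suc n) k)"
    using x y by (subst finsum_Suc2) auto
  finally show ?case .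
qed

text \<open>\<open>p\<close> divides \<open>p choose k\<close> for \<open>0 < k < p\<close>, so only
  the two outer terms of the binomial expansion survive. Stating the characteristic as an equation
  in a commutative ring covers both a field and the polynomials over it.\<close>

lemma (in cring) frobenius_add:
  assumes p: "Factorial_Ring.prime (p::nat)" and char: "[p] \<cdot> \<one> = \<zero>"
    and x: "x \<in> carrier R" and y: "y \<in> carrier R"
  shows "(x \<oplus> y) [^] p = x [^] p \<oplus> y [^] p"
proof -
  have pos: "p > 0" using p by (rule prime_gt_0_nat)
  have mult: "[n] \<cdot> z = \<zero>" if dvd: "p dvd n" and z: "z \<in> carrier R" for n :: nat and z
  proof -
    obtain m where n: "n = p * m" using dvd unfolding dvd_def by auto
    have "[p] \<cdot> z = ([p] \<cdot> \<one>) \<otimes> z" using z by (simp add: add_pow_ldistr)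
    then have "[p] \<cdot> z = \<zero>" using char z by simp
    then show ?thesis using z unfolding n by (metis add.nat_pow_one add.nat_pow_pow)
  qed
  obtain m where m: "p = Suc m" using pos by (cases p) auto
  let ?t = "\<lambda>k. [(p choose k)] \<cdot> (x [^] k \<otimes> y [^] (p - k))"
  have "(x \<oplus> y) [^] p = (\<Oplus>k\<in>{..p}. ?t k)"
    using x y by (rule binomial_expansion)
  also have "\<dots> = (\<Oplus>k\<in>{..p}. if k = 0 then y [^] p else if k = p then x [^] p else \<zero>)"
  proof (rule finsum_cong')
    fix k assume "k \<in> {..p}"
    then consider "k = 0" | "k = p" | "0 < k" "k < p" by fastforce
    then show "?t k = (if k = 0 then y [^] p else if k = p then x [^] p else \<zero>)"
    proof cases
      case 3
      then have "p dvd (p choose k)" using p by (intro dvd_choose_prime) auto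
      then show ?thesis using 3 x y by (simp add: mult)
    qed (use x y pos in auto)
  qed (use x y in auto)
  also have "\<dots> = x [^] p \<oplus> y [^] p"
  proof -
    \<comment> \<open>Since \<open>p = Suc m\<close>, the term \<open>k = p\<close> is the one
      outside \<open>{..m}\<close>. The test is turned into \<open>0 = k\<close> to match the
      singleton-sum rule.\<close>
    have "(\<Oplus>k\<in>{..m}. if k = 0 then y [^] p else if k = p then x [^] p else \<zero>)
        = (\<Oplus>k\<in>{..m}. if 0 = k then y [^] p else \<zero>)"
      using x y by (intro finsum_cong') (auto simp: m)
    also have "\<dots> = y [^] p" using y by (subst add.finprod_singleton) auto
    finally show ?thesis using x y unfolding m by (subst finsum_Suc) auto
  qed
  finally show ?thesis .
qed

lemma (in cring) frobenius_add_power: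
  assumes p: "Factorial_Ring.prime (p::nat)" and char: "[p] \<cdot> \<one> = \<zero>"
    and "x \<in> carrier R" "y \<in> carrier R"
  shows "(x \<oplus> y) [^] (p ^ e) = x [^] (p ^ e) \<oplus> y [^] (p ^ e)"
proof (induction e)
  case 0
  then show ?case using assms by simp
next
  case (Suc e)
  have "z [^] (p ^ Suc e) = (z [^] (p ^ e)) [^] p" if "z \<in> carrier R" for z
    using that by (simp add: nat_pow_pow mult.commute)
  then show ?case using assms Suc by (simp add: frobenius_add[OF p char])
qed

text \<open>Additivity applied to \<open>\<ominus> x \<oplus> x = \<zero>\<close> gives this without
  separating \<open>p = 2\<close> from odd \<open>p\<close>.\<close>

lemma (in cring) frobenius_minus_power:
  assumes p: "Factorial_Ring.prime (p::nat)" and char: "[p] \<cdot> \<one> = \<zero>" and x: "x \<in> carrier R"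
  shows "(\<ominus> x) [^] (p ^ e) = \<ominus> (x [^] (p ^ e))"
proof -
  have "(\<ominus> x) [^] (p ^ e) \<oplus> x [^] (p ^ e) = (\<ominus> x \<oplus> x) [^] (p ^ e)"
    using assms by (simp add: frobenius_add_power[OF p char])
  also have "\<dots> = \<zero>" using x prime_gt_0_nat[OF p] by (simp add: l_neg nat_pow_zero)
  finally show ?thesis using x by (intro sum_zero_eq_neg) auto
qed

text \<open>The power map is a ring endomorphism, so its fixed points form a subring. If
  \<open>k\<close> is a nonzero fixed point, the power of \<open>inv k\<close> is again an inverse
  of \<open>k\<close>, hence equal to \<open>inv k\<close>.\<close>

lemma (in field) subfield_frobenius_fixed:
  assumes p: "Factorial_Ring.prime (p::nat)" and char: "[p] \<cdot> \<one> = \<zero>"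
  shows "subfield {x \<in> carrier R. x [^] (p ^ e) = x} R" (is "subfield ?K R")
proof (rule subfieldI')
  show "subring ?K R"
    using assms by (intro subringI)
      (auto simp: frobenius_add_power frobenius_minus_power nat_pow_distrib)
  show "inv k \<in> ?K" if "k \<in> ?K - {\<zero>}" for k
  proof -
    have k: "k \<in> Units R" "k \<in> carrier R" "k [^] (p ^ e) = k" using that field_Units by auto
    have "(inv k) [^] (p ^ e) \<otimes> k = (inv k) [^] (p ^ e) \<otimes> k [^] (p ^ e)"
      using k(3) by simp
    also have "\<dots> = (inv k \<otimes> k) [^] (p ^ e)"
      using k by (intro nat_pow_distrib[symmetric]) auto
    also have "\<dots> = \<one>" using k by simp
    finally show ?thesis using k
      by (metis (mono_tags, lifting) Units_inv_closed inv_char m_comm mem_Collect_eq nat_pow_closed)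
  qed
qed

lemma (in ring_hom_ring) hom_add_pow:
  assumes "x \<in> carrier R"
  shows "h ([(n::nat)] \<cdot>\<^bsub>R\<^esub> x) = [n] \<cdot>\<^bsub>S\<^esub> h x"
  using assms by (induction n) auto

text \<open>The set consists of the roots of \<open>X^q - X\<close> with \<open>q = p ^ e\<close>,
  which splits, so only simplicity of the roots is at stake. Instead of a derivative, a shift is
  used: for a root \<open>a\<close> and \<open>U = X - a\<close> the polynomial equals
  \<open>U^q - U = U (U^(q-1) - 1)\<close>, and the second factor has value \<open>-1\<close> at
  \<open>a\<close>.\<close>

lemma (in algebraically_closed) card_frobenius_fixed:
  assumes p: "Factorial_Ring.prime (p::nat)" and char: "[p] \<cdot> \<one> = \<zero>" and "e > 0"
  shows "card {x \<in> carrier L. x [^] (p ^ e) = x} = p ^ e"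
proof -
  define q where "q = p ^ e"
  have q: "q > 1" using assms prime_gt_1_nat one_less_power unfolding q_def by blast
  interpret UP: domain "poly_ring L"
    using univ_poly_is_domain[OF carrier_is_subring] .
  let ?P = "poly_ring L"
  have X: "X \<in> carrier ?P" by (rule var_closed[OF carrier_is_subring])
  define f where "f = X [^]\<^bsub>?P\<^esub> q \<ominus>\<^bsub>?P\<^esub> X"
  have f: "f \<in> carrier ?P" unfolding f_def using X by simp
  have degX: "degree X = 1" by (simp add: var_def)
  have deg: "degree f = q"
  proof -
    have "degree (X [^]\<^bsub>?P\<^esub> q) = q" using polynomial_pow_degree[OF X] degX by simp
    moreover have "degree (\<ominus>\<^bsub>?P\<^esub> X) = 1"
      using univ_poly_a_inv_degree[OF carrier_is_subring X] degX by simp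
    \<comment> \<open>The degrees \<open>q\<close> and \<open>1\<close> differ because
      \<open>e > 0\<close> forces \<open>q > 1\<close>, so the larger one is the degree of the
      sum.\<close>
    ultimately show ?thesis
      using poly_add_degree_eq[OF carrier_is_subring, of "X [^]\<^bsub>?P\<^esub> q" "\<ominus>\<^bsub>?P\<^esub> X"] X q
      unfolding f_def a_minus_def univ_poly_add univ_poly_carrier by simp
  qed
  have nz: "f \<noteq> []" using deg q by auto
  \<comment> \<open>The embedding of constants carries the characteristic over, which makes the
    Frobenius identities available for polynomials.\<close>
  have charP: "[p] \<cdot>\<^bsub>?P\<^esub> \<one>\<^bsub>?P\<^esub> = \<zero>\<^bsub>?P\<^esub>"
  proof -
    have "ring_hom_ring L ?P poly_of_const"
      using canonical_embedding_ring_hom[OF carrier_is_subring] by simp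
    then interpret C: ring_hom_ring L ?P poly_of_const .
    show ?thesis using C.hom_add_pow[of "\<one>" p] char by simp
  qed
  have eval_f: "eval f a = a [^] q \<ominus> a" if "a \<in> carrier L" for a
  proof -
    interpret E: ring_hom_ring ?P L "\<lambda>p. eval p a"
      using eval_ring_hom[OF carrier_is_subring that] .
    show ?thesis using X that by (simp add: f_def a_minus_def E.hom_nat_pow eval_var)
  qed
  have root_iff: "is_root f a \<longleftrightarrow> a \<in> carrier L \<and> a [^] q = a" for a
    using nz eval_f by (auto simp: is_root_def r_right_minus_eq)
  have simple: "count (roots f) a = 1" if "a \<in># roots f" for a
  proof -
    have a: "a \<in> carrier L" "a [^] q = a"
      using that roots_mem_iff_is_root[OF f] root_iff by auto
    \<comment> \<open>Coefficient lists begin with the leading coefficient, so this is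
      \<open>X - a\<close>.\<close>
    define U where "U = [\<one>, \<ominus> a]"
    have U: "U \<in> carrier ?P"
      using a unfolding U_def sym[OF univ_poly_carrier] polynomial_def by auto
    have U_nz: "U \<noteq> \<zero>\<^bsub>?P\<^esub>" by (simp add: U_def univ_poly_zero)
    have "ring_hom_ring L ?P poly_of_const"
      using canonical_embedding_ring_hom[OF carrier_is_subring] by simp
    then interpret C: ring_hom_ring L ?P poly_of_const .
    define c where "c = poly_of_const a"
    have c: "c \<in> carrier ?P" "c [^]\<^bsub>?P\<^esub> q = c"
      using a C.hom_nat_pow[of a q] by (simp_all add: c_def)
    \<comment> \<open>The constant polynomial of \<open>\<zero>\<close> is the empty list, hence the
      case distinction on \<open>a\<close>.\<close>
    have X_eq: "X = U \<oplus>\<^bsub>?P\<^esub> c"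
      using a by (cases "a = \<zero>") (simp_all add: U_def c_def var_def univ_poly_add poly_of_const_def l_neg)
    have "f = (U [^]\<^bsub>?P\<^esub> q \<oplus>\<^bsub>?P\<^esub> c) \<ominus>\<^bsub>?P\<^esub> (U \<oplus>\<^bsub>?P\<^esub> c)"
      using UP.frobenius_add_power[OF p charP U c(1), of e] c(2)
      unfolding f_def X_eq q_def by simp
    also have "\<dots> = U [^]\<^bsub>?P\<^esub> q \<ominus>\<^bsub>?P\<^esub> U"
    proof -
      have "(z \<oplus>\<^bsub>?P\<^esub> c) \<ominus>\<^bsub>?P\<^esub> (U \<oplus>\<^bsub>?P\<^esub> c) = z \<ominus>\<^bsub>?P\<^esub> U"
        if "z \<in> carrier ?P" for z
        using that U c(1) by algebra
      then show ?thesis using U by simp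
    qed
    also have "\<dots> = U \<otimes>\<^bsub>?P\<^esub> (U [^]\<^bsub>?P\<^esub> (q - 1) \<ominus>\<^bsub>?P\<^esub> \<one>\<^bsub>?P\<^esub>)"
    proof -
      have "U [^]\<^bsub>?P\<^esub> q = U \<otimes>\<^bsub>?P\<^esub> U [^]\<^bsub>?P\<^esub> (q - 1)"
        using U q UP.nat_pow_Suc2[of U "q - 1"] by simp
      then show ?thesis using U by (simp add: a_minus_def UP.r_distr UP.r_minus)
    qed
    finally have f_eq: "f = U \<otimes>\<^bsub>?P\<^esub> (U [^]\<^bsub>?P\<^esub> (q - 1) \<ominus>\<^bsub>?P\<^esub> \<one>\<^bsub>?P\<^esub>)" .
    \<comment> \<open>A double root would let \<open>U\<close> divide \<open>U^(q-1) - 1\<close>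
      after cancelling one factor \<open>U\<close>; evaluating at \<open>a\<close>, where
      \<open>q - 1 > 0\<close> matters, would give
      \<open>\<ominus> \<one> = \<zero>\<close>.\<close>
    have "\<not> 2 \<le> alg_mult f a"
    proof
      assume "2 \<le> alg_mult f a"
      then have "(U [^]\<^bsub>?P\<^esub> (2::nat)) pdivides f"
        using le_alg_mult_imp_pdivides[OF a(1) f] unfolding U_def by blast
      then obtain s where s: "s \<in> carrier ?P" "f = (U [^]\<^bsub>?P\<^esub> (2::nat)) \<otimes>\<^bsub>?P\<^esub> s"
        unfolding pdivides_def factor_def by auto
      then have "f = U \<otimes>\<^bsub>?P\<^esub> (U \<otimes>\<^bsub>?P\<^esub> s)"
        using U by (simp add: numeral_2_eq_2 UP.m_assoc)
      then have "U [^]\<^bsub>?P\<^esub> (q - 1) \<ominus>\<^bsub>?P\<^esub> \<one>\<^bsub>?P\<^esub> = U \<otimes>\<^bsub>?P\<^esub> s"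
        using f_eq UP.m_lcancel[OF U_nz U] U s(1) by simp
      then have eq: "eval (U [^]\<^bsub>?P\<^esub> (q - 1) \<ominus>\<^bsub>?P\<^esub> \<one>\<^bsub>?P\<^esub>) a = eval (U \<otimes>\<^bsub>?P\<^esub> s) a"
        by simp
      interpret E: ring_hom_ring ?P L "\<lambda>p. eval p a"
        using eval_ring_hom[OF carrier_is_subring a(1)] .
      have "eval U a = \<zero>" using a(1) by (simp add: U_def r_neg)
      moreover have "\<zero> [^] (q - 1) = \<zero>" using q by (simp add: nat_pow_zero)
      moreover have "eval (U [^]\<^bsub>?P\<^esub> (q - 1) \<ominus>\<^bsub>?P\<^esub> \<one>\<^bsub>?P\<^esub>) a = eval U a [^] (q - 1) \<ominus> \<one>"
        using U by (simp add: a_minus_def E.hom_nat_pow)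
      moreover have "eval (U \<otimes>\<^bsub>?P\<^esub> s) a = eval U a \<otimes> eval s a"
        using U s(1) by simp
      moreover have "eval s a \<in> carrier L" using s(1) by simp
      ultimately have "\<ominus> \<one> = \<zero>" using eq by (simp add: a_minus_def)
      then show False using minus_minus[of "\<one>"] by simp
    qed
    then have "count (roots f) a < 2" by (simp add: alg_mult_eq_count_roots[OF f])
    moreover have "count (roots f) a > 0" using that by simp
    ultimately show ?thesis by linarith
  qed
  have "card {x \<in> carrier L. x [^] q = x} = card (set_mset (roots f))"
    using roots_mem_iff_is_root[OF f] root_iff by (intro arg_cong[of _ _ card]) auto
  also have "\<dots> = size (roots f)"
    using simple by (simp add: size_multiset_overloaded_eq)
  also have "\<dots> = q" using roots_over_carrier[OF f] deg by (simp add: splitted_def)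
  finally show ?thesis by (simp add: q_def)
qed

text \<open>The type of \<open>F\<close> is the one in which the algebraic closure of the residue
  ring modulo \<open>p\<close>, a ring of integers, is built. The embedding into the closure
  transfers the characteristic, and the fixed field of the power map is the required field.\<close>

lemma finite_field_exists:
  assumes p: "Factorial_Ring.prime (p::nat)" and "e > 0"
  obtains F :: "(((int list \<times> nat) multiset) \<Rightarrow> int) ring"
  where "field F" "card (carrier F) = p ^ e"
proof -
  let ?Z = "residue_ring (int p)"
  interpret Z: residues_prime p ?Z using p by unfold_locales simp_all
  obtain L :: "(((int list \<times> nat) multiset) \<Rightarrow> int) ring"
    where L: "algebraic_closure L (Z.indexed_const ` carrier ?Z)" "Z.indexed_const \<in> ring_hom ?Z L"
    using Z.exists_closure .
  interpret L: algebraic_closure L "Z.indexed_const ` carrier ?Z" by (rule L(1))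
  interpret H: ring_hom_ring ?Z L Z.indexed_const
    using L(2) by (intro ring_hom_ringI2 Z.ring_axioms L.ring_axioms)
  have "[n] \<cdot>\<^bsub>?Z\<^esub> \<one>\<^bsub>?Z\<^esub> = int n mod int p" for n :: nat
    by (induction n) (simp_all add: Z.res_add_eq Z.res_one_eq Z.res_zero_eq mod_add_right_eq add.commute)
  then have "[p] \<cdot>\<^bsub>?Z\<^esub> \<one>\<^bsub>?Z\<^esub> = \<zero>\<^bsub>?Z\<^esub>" by (simp add: Z.res_zero_eq)
  then have char: "[p] \<cdot>\<^bsub>L\<^esub> \<one>\<^bsub>L\<^esub> = \<zero>\<^bsub>L\<^esub>"
    using H.hom_add_pow[of "\<one>\<^bsub>?Z\<^esub>" p] by simp
  let ?K = "{x \<in> carrier L. x [^]\<^bsub>L\<^esub> (p ^ e) = x}"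
  show thesis
  proof
    show "field (L\<lparr>carrier := ?K\<rparr>)"
      using L.subfield_frobenius_fixed[OF p char] by (rule L.subfield_iff(2))
    show "card (carrier (L\<lparr>carrier := ?K\<rparr>)) = p ^ e"
      using L.card_frobenius_fixed[OF p char assms(2)] by simp
  qed
qed

section \<open>Orthogonal families\<close>

text \<open>An orthogonal array of strength two with \<open>n + 1\<close> columns, the last one being \<open>y\<close> itself
  (equivalently, up to renaming, \<open>n - 1\<close> mutually orthogonal Latin squares of order \<open>v\<close>).\<close>

definition orthogonal_family :: "nat \<Rightarrow> nat \<Rightarrow> (nat \<Rightarrow> nat \<Rightarrow> nat \<Rightarrow> nat) \<Rightarrow> bool" where
  "orthogonal_family v n f \<longleftrightarrow>
     (\<forall>m<n. \<forall>x<v. \<forall>y<v. f m x y < v) \<and>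
     (\<forall>m<n. \<forall>y<v. inj_on (\<lambda>x. f m x y) {..<v}) \<and>
     (\<forall>m<n. \<forall>m'<n. \<forall>x<v. \<forall>y<v. \<forall>x'<v. \<forall>y'<v.
        m \<noteq> m' \<longrightarrow> f m x y = f m x' y' \<longrightarrow> f m' x y = f m' x' y' \<longrightarrow> y = y')"

lemma orthogonal_familyD:
  assumes "orthogonal_family v n f" "m < n"
  shows "x < v \<Longrightarrow> y < v \<Longrightarrow> f m x y < v"
    and "y < v \<Longrightarrow> inj_on (\<lambda>x. f m x y) {..<v}"
    and "m' < n \<Longrightarrow> m \<noteq> m' \<Longrightarrow> x < v \<Longrightarrow> y < v \<Longrightarrow> x' < v \<Longrightarrow> y' < v \<Longrightarrow>
      f m x y = f m x' y' \<Longrightarrow> f m' x y = f m' x' y' \<Longrightarrow> y = y'"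
proof -
  note * = assms(1)[unfolded orthogonal_family_def]
  show "x < v \<Longrightarrow> y < v \<Longrightarrow> f m x y < v"
    by (rule *[THEN conjunct1, rule_format, OF assms(2)])
  show "y < v \<Longrightarrow> inj_on (\<lambda>x. f m x y) {..<v}"
    by (rule *[THEN conjunct2, THEN conjunct1, rule_format, OF assms(2)])
  show "m' < n \<Longrightarrow> m \<noteq> m' \<Longrightarrow> x < v \<Longrightarrow> y < v \<Longrightarrow> x' < v \<Longrightarrow> y' < v \<Longrightarrow>
      f m x y = f m x' y' \<Longrightarrow> f m' x y = f m' x' y' \<Longrightarrow> y = y'"
    by (rule *[THEN conjunct2, THEN conjunct2, rule_format, OF assms(2)])
qed

lemma orthogonal_family_one: "orthogonal_family 1 n (\<lambda>m x y. 0)"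
  by (simp add: orthogonal_family_def inj_on_def)

text \<open>Fields of different orders yield families of different sizes; truncation to the smallest
  size makes them compatible with the product.\<close>

lemma orthogonal_family_mono:
  assumes f: "orthogonal_family v n f" and "n' \<le> n"
  shows "orthogonal_family v n' f"
  unfolding orthogonal_family_def
proof (intro conjI allI impI)
  fix m assume "m < n'"
  then have m: "m < n" using assms(2) by simp
  note * = orthogonal_familyD[OF f m]
  show "f m x y < v" if "x < v" "y < v" for x y using *(1) that .
  show "inj_on (\<lambda>x. f m x y) {..<v}" if "y < v" for y using *(2) that .
  show "y = y'" if "m' < n'" "x < v" "y < v" "x' < v" "y' < v" "m \<noteq> m'"
    "f m x y = f m x' y'" "f m' x y = f m' x' y'" for m' x y x' y'
    by (rule *(3)[of m' x y x' y']) (use that assms(2) in auto)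
qed

lemma mixed_radix_less:
  fixes a b x y :: nat
  assumes "x < a" "y < b"
  shows "x + a * y < a * b"
proof -
  have "x + a * y < a * Suc y" using assms(1) by simp
  also have "\<dots> \<le> a * b" using assms(2) by (intro mult_le_mono2) simp
  finally show ?thesis .
qed

lemma mixed_radix_eq_iff:
  fixes a x x' y y' :: nat
  assumes "x < a" "x' < a"
  shows "x + a * y = x' + a * y' \<longleftrightarrow> x = x' \<and> y = y'"
proof
  assume eq: "x + a * y = x' + a * y'"
  have "x = x'" using arg_cong[OF eq, of "\<lambda>z. z mod a"] assms by simp
  with eq assms show "x = x' \<and> y = y'" by auto
qed simp

text \<open>MacNeish's product: a symbol below \<open>a * b\<close> is a pair of digits,
  \<open>x mod a\<close> and \<open>x div a\<close>, and \<open>f\<close> and \<open>g\<close> act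
  on the digits separately. Equal values have equal digits, so each property follows from those of
  the factors.\<close>

lemma orthogonal_family_prod:
  assumes f: "orthogonal_family a n f" and g: "orthogonal_family b n g"
  shows "orthogonal_family (a * b) n
           (\<lambda>m x y. f m (x mod a) (y mod a) + a * g m (x div a) (y div a))"
proof -
  have lt: "x mod a < a" "x div a < b" if "x < a * b" for x
    using that by (metis mod_less_divisor mult_is_0 not_gr_zero not_less_zero)
      (simp add: less_mult_imp_div_less mult.commute that)
  note fb = orthogonal_familyD(1)[OF f] and fi = inj_onD[OF orthogonal_familyD(2)[OF f]]
    and fo = orthogonal_familyD(3)[OF f]
  note gb = orthogonal_familyD(1)[OF g] and gi = inj_onD[OF orthogonal_familyD(2)[OF g]]
    and go = orthogonal_familyD(3)[OF g]
  have eqI: "x = y" if "x mod a = y mod a" "x div a = y div a" for x y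
    using that by (metis div_mult_mod_eq)
  show ?thesis
    unfolding orthogonal_family_def
  proof (intro conjI allI impI inj_onI)
    fix m x y assume "m < n" "x < a * b" "y < a * b"
    then show "f m (x mod a) (y mod a) + a * g m (x div a) (y div a) < a * b"
      by (intro mixed_radix_less fb gb lt)
  next
    fix m y x x'
    assume *: "m < n" "y < a * b" "x \<in> {..<a * b}" "x' \<in> {..<a * b}"
      and **: "f m (x mod a) (y mod a) + a * g m (x div a) (y div a)
         = f m (x' mod a) (y mod a) + a * g m (x' div a) (y div a)"
    have "f m (x mod a) (y mod a) = f m (x' mod a) (y mod a)"
      "g m (x div a) (y div a) = g m (x' div a) (y div a)"
      using * ** by (simp_all add: mixed_radix_eq_iff fb lt)
    then have "x mod a = x' mod a" "x div a = x' div a"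
      using * fi[of m "y mod a" "x mod a" "x' mod a"] gi[of m "y div a" "x div a" "x' div a"]
      by (simp_all add: lt)
    then show "x = x'"
      by (rule eqI)
  next
    fix m m' x y x' y'
    assume *: "m < n" "m' < n" "x < a * b" "y < a * b" "x' < a * b" "y' < a * b" "m \<noteq> m'"
      and **: "f m (x mod a) (y mod a) + a * g m (x div a) (y div a)
         = f m (x' mod a) (y' mod a) + a * g m (x' div a) (y' div a)"
      and ***: "f m' (x mod a) (y mod a) + a * g m' (x div a) (y div a)
         = f m' (x' mod a) (y' mod a) + a * g m' (x' div a) (y' div a)"
    have "f m (x mod a) (y mod a) = f m (x' mod a) (y' mod a)"
      "g m (x div a) (y div a) = g m (x' div a) (y' div a)"
      using * ** by (simp_all add: mixed_radix_eq_iff fb lt)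
    moreover have "f m' (x mod a) (y mod a) = f m' (x' mod a) (y' mod a)"
      "g m' (x div a) (y div a) = g m' (x' div a) (y' div a)"
      using * *** by (simp_all add: mixed_radix_eq_iff fb lt)
    ultimately have "y mod a = y' mod a" "y div a = y' div a"
      using * fo[of m m' "x mod a" "y mod a" "x' mod a" "y' mod a"]
        go[of m m' "x div a" "y div a" "x' div a" "y' div a"] by (simp_all add: lt)
    then show "y = y'"
      by (rule eqI)
  qed
qed

lemma orthogonal_family_prod_set:
  assumes "finite S" and "\<And>s. s \<in> S \<Longrightarrow> \<exists>f. orthogonal_family (q s) n f"
  shows "\<exists>f. orthogonal_family (\<Prod>s\<in>S. q s) n f"
  using assms
proof (induction S rule: finite_induct)
  case empty
  then show ?case using orthogonal_family_one by auto
next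
  case (insert s S)
  obtain f where "orthogonal_family (q s) n f" using insert.prems by blast
  moreover obtain g where "orthogonal_family (\<Prod>s\<in>S. q s) n g" using insert.IH insert.prems by blast
  ultimately show ?case using orthogonal_family_prod insert.hyps by fastforce
qed

text \<open>Together with the next lemma: \<open>t\<close> consecutive columns meet each residue
  modulo \<open>t\<close> exactly once. The witness represents \<open>s - i\<close> modulo
  \<open>t\<close>, written so that the truncated subtraction is exact.\<close>

lemma mod_shift_surj:
  fixes i s t :: nat
  assumes "s < t"
  obtains j where "j < t" "(i + j) mod t = s"
proof
  show "(s + (t - i mod t)) mod t < t" using assms by simp
  have "(i + (s + (t - i mod t)) mod t) mod t = (i mod t + (s + (t - i mod t))) mod t"
    by (metis mod_add_left_eq mod_add_right_eq)
  also have "i mod t + (s + (t - i mod t)) = s + t"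
    using assms mod_less_divisor[of t i] by linarith
  finally show "(i + (s + (t - i mod t)) mod t) mod t = s" using assms by simp
qed

lemma mod_shift_inj:
  fixes i j j' t :: nat
  assumes "j < t" "j' < t" "(i + j) mod t = (i + j') mod t"
  shows "j = j'"
  using assms by (metis cong_add_lcancel_nat cong_def mod_less)

text \<open>The maps are \<open>x + m y\<close>, transported to numbers by an enumeration
  \<open>\<delta>\<close> of the field and its inverse \<open>\<epsilon>\<close>. Subtracting the
  equations for slopes \<open>m\<close> and \<open>m'\<close> leaves
  \<open>(m - m') (b - b') = 0\<close>, so distinct slopes determine the second variable.\<close>

lemma orthogonal_family_if_field:
  assumes "field F" and card: "card (carrier F) = q" and "q > 0"
  shows "\<exists>f. orthogonal_family q q f"
proof -
  interpret field F by (rule assms(1))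
  have "finite (carrier F)" using assms(2,3) card_gt_0_iff by blast
  then obtain \<delta> where \<delta>: "bij_betw \<delta> {..<q} (carrier F)"
    using ex_bij_betw_nat_finite[of "carrier F"] card atLeast0LessThan by metis
  define \<epsilon> where "\<epsilon> = inv_into {..<q} \<delta>"
  have \<delta>_closed: "\<delta> x \<in> carrier F" if "x < q" for x using bij_betwE[OF \<delta>] that by simp
  have \<delta>_eqD: "x = y" if "\<delta> x = \<delta> y" "x < q" "y < q" for x y
    using inj_onD[OF bij_betw_imp_inj_on[OF \<delta>]] that by simp
  have \<epsilon>_less: "\<epsilon> a < q" if "a \<in> carrier F" for a
    using bij_betwE[OF bij_betw_inv_into[OF \<delta>]] that by (simp add: \<epsilon>_def)
  have \<epsilon>_eqD: "a = b" if "\<epsilon> a = \<epsilon> b" "a \<in> carrier F" "b \<in> carrier F" for a b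
    using inj_onD[OF bij_betw_imp_inj_on[OF bij_betw_inv_into[OF \<delta>]]] that by (simp add: \<epsilon>_def)
  define f where "f m x y = \<epsilon> (\<delta> x \<oplus>\<^bsub>F\<^esub> \<delta> m \<otimes>\<^bsub>F\<^esub> \<delta> y)" for m x y
  have f_eqD: "\<delta> x \<oplus>\<^bsub>F\<^esub> \<delta> m \<otimes>\<^bsub>F\<^esub> \<delta> y = \<delta> x' \<oplus>\<^bsub>F\<^esub> \<delta> m \<otimes>\<^bsub>F\<^esub> \<delta> y'"
    if "f m x y = f m x' y'" "m < q" "x < q" "y < q" "x' < q" "y' < q" for m x y x' y'
    using that unfolding f_def by (intro \<epsilon>_eqD) (simp_all add: \<delta>_closed)
  have cancel: "b = b'"
    if "a \<oplus>\<^bsub>F\<^esub> m \<otimes>\<^bsub>F\<^esub> b = a' \<oplus>\<^bsub>F\<^esub> m \<otimes>\<^bsub>F\<^esub> b'"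
      "a \<oplus>\<^bsub>F\<^esub> m' \<otimes>\<^bsub>F\<^esub> b = a' \<oplus>\<^bsub>F\<^esub> m' \<otimes>\<^bsub>F\<^esub> b'"
      "m \<noteq> m'" and c: "a \<in> carrier F" "a' \<in> carrier F" "b \<in> carrier F" "b' \<in> carrier F"
      "m \<in> carrier F" "m' \<in> carrier F" for a a' b b' m m'
  proof -
    have "(m \<ominus>\<^bsub>F\<^esub> m') \<otimes>\<^bsub>F\<^esub> (b \<ominus>\<^bsub>F\<^esub> b')
        = ((a \<oplus>\<^bsub>F\<^esub> m \<otimes>\<^bsub>F\<^esub> b) \<ominus>\<^bsub>F\<^esub> (a' \<oplus>\<^bsub>F\<^esub> m \<otimes>\<^bsub>F\<^esub> b'))
          \<ominus>\<^bsub>F\<^esub> ((a \<oplus>\<^bsub>F\<^esub> m' \<otimes>\<^bsub>F\<^esub> b) \<ominus>\<^bsub>F\<^esub> (a' \<oplus>\<^bsub>F\<^esub> m' \<otimes>\<^bsub>F\<^esub> b'))"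
      using c by algebra
    also have "\<dots> = \<zero>\<^bsub>F\<^esub>" using c unfolding that(1,2) by (simp add: a_minus_def r_neg)
    finally show ?thesis using c that(3) by (simp add: integral_iff)
  qed
  have "orthogonal_family q q f"
    unfolding orthogonal_family_def
  proof (intro conjI allI impI inj_onI)
    fix m x y assume "m < q" "x < q" "y < q"
    then show "f m x y < q" unfolding f_def by (intro \<epsilon>_less) (simp add: \<delta>_closed)
  next
    fix m y x x' assume *: "m < q" "y < q" "x \<in> {..<q}" "x' \<in> {..<q}" and "f m x y = f m x' y"
    then have "\<delta> x \<oplus>\<^bsub>F\<^esub> \<delta> m \<otimes>\<^bsub>F\<^esub> \<delta> y = \<delta> x' \<oplus>\<^bsub>F\<^esub> \<delta> m \<otimes>\<^bsub>F\<^esub> \<delta> y"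
      by (intro f_eqD) auto
    then show "x = x'" using * by (intro \<delta>_eqD) (simp_all add: \<delta>_closed)
  next
    fix m m' x y x' y'
    assume *: "m < q" "m' < q" "x < q" "y < q" "x' < q" "y' < q" "m \<noteq> m'"
      and eq: "f m x y = f m x' y'" "f m' x y = f m' x' y'"
    have "\<delta> m \<noteq> \<delta> m'" using * \<delta>_eqD by blast
    then have "\<delta> y = \<delta> y'"
      using * by (intro cancel[OF f_eqD[OF eq(1)] f_eqD[OF eq(2)]]) (simp_all add: \<delta>_closed)
    then show "y = y'" using * by (intro \<delta>_eqD)
  qed
  then show ?thesis by blast
qed

section \<open>Consecutive detecting arrays\<close>

definition cda_entry ::
    "(nat \<Rightarrow> nat \<Rightarrow> nat \<Rightarrow> nat) \<Rightarrow> nat \<Rightarrow> nat \<times> nat list \<Rightarrow> nat \<Rightarrow> nat" where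
  "cda_entry f t w c = f (c div t) (snd w ! (c mod t)) (fst w)"

definition cda_rows :: "nat \<Rightarrow> nat \<Rightarrow> nat \<Rightarrow> (nat \<times> nat list) set" where
  "cda_rows d t v = {..d} \<times> {zs. set zs \<subseteq> {..<v} \<and> length zs = t}"

lemma card_cda_rows: "card (cda_rows d t v) = (d + 1) * v ^ t"
  unfolding cda_rows_def card_cartesian_product using card_lists_length_eq[of "{..<v}" t] by simp

lemma finite_cda_rows: "finite (cda_rows d t v)"
  unfolding cda_rows_def by (intro finite_cartesian_product finite_lists_length_eq) auto

lemma cda_rowsD:
  assumes "(y, zs) \<in> cda_rows d t v"
  shows "y \<le> d" "length zs = t" "s < t \<Longrightarrow> zs ! s < v"
  using assms nth_mem by (fastforce simp: cda_rows_def)+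

text \<open>\<open>t * k - (k + t - 1) = (t - 1) * (k - 1)\<close> is nonnegative, so the array
  never asks for a map beyond the \<open>k\<close> available ones.\<close>

lemma column_block_less:
  fixes c k t :: nat
  assumes "c < k + t - 1" "t > 0" "k > 0"
  shows "c div t < k"
proof -
  have "k + t - 1 \<le> t * k"
    using assms(2,3) by (cases k; cases t) auto
  then have "c < t * k" using assms(1) by linarith
  then show ?thesis by (simp add: less_mult_imp_div_less mult.commute)
qed

text \<open>For fixed \<open>y\<close> every letter occurs in just one column of the window, so the
  \<open>t\<close> conditions decouple into one equation per letter. Each is solvable because an
  injective self-map of a finite set is surjective.\<close>

lemma cda_row_covering:
  assumes f: "orthogonal_family v k f" and "t > 0" "d < v"
    and T: "(i, xs) \<in> consec_interactions (k + t - 1) t v" and "y \<le> d"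
  obtains zs where "(y, zs) \<in> cda_rows d t v" "\<And>j. j < t \<Longrightarrow> cda_entry f t (y, zs) (i + j) = xs ! j"
proof -
  have it: "i + t \<le> k + t - 1" and len: "length xs = t" and xs: "set xs \<subseteq> {..<v}"
    using T by (auto simp: consec_interactions_def)
  have "\<exists>x<v. \<forall>j<t. (i + j) mod t = s \<longrightarrow> f ((i + j) div t) x y = xs ! j" if s: "s < t" for s
  proof -
    obtain j where j: "j < t" "(i + j) mod t = s" using mod_shift_surj[OF s] .
    let ?g = "\<lambda>x. f ((i + j) div t) x y"
    have blk: "(i + j) div t < k" using j(1) it assms(2) by (intro column_block_less) auto
    have "inj_on ?g {..<v}" "?g ` {..<v} \<subseteq> {..<v}"
      using orthogonal_familyD(1,2)[OF f blk] assms(3,5) by auto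
    then have "?g ` {..<v} = {..<v}" by (intro endo_inj_surj) auto
    moreover have "xs ! j \<in> {..<v}" using xs len j(1) nth_mem by blast
    ultimately obtain x where "x < v" "?g x = xs ! j" by (metis (no_types, lifting) imageE lessThan_iff)
    moreover have "j' = j" if "j' < t" "(i + j') mod t = s" for j'
      using mod_shift_inj that j by metis
    ultimately show ?thesis by blast
  qed
  then obtain z where z: "\<And>s. s < t \<Longrightarrow> z s < v"
    "\<And>s j. s < t \<Longrightarrow> j < t \<Longrightarrow> (i + j) mod t = s \<Longrightarrow> f ((i + j) div t) (z s) y = xs ! j"
    by metis
  show thesis
  proof
    show "(y, map z [0..<t]) \<in> cda_rows d t v"
      using z(1) assms(5) by (auto simp: cda_rows_def)
    show "cda_entry f t (y, map z [0..<t]) (i + j) = xs ! j" if "j < t" for j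
      using z(2)[OF _ that refl] assms(2) by (simp add: cda_entry_def)
  qed
qed

text \<open>One letter seen through two different maps determines \<open>y\<close>; then injectivity
  in the first variable recovers every letter from the first window.\<close>

lemma cda_row_unique:
  assumes f: "orthogonal_family v k f" and "t > 0" "d < v"
    and bound: "i' + t \<le> k + t - 1" and "i < i'"
    and w: "w \<in> cda_rows d t v" and w': "w' \<in> cda_rows d t v"
    and eq: "\<And>j. j < t \<Longrightarrow> cda_entry f t w (i + j) = cda_entry f t w' (i + j)"
    and eq': "\<And>j. j < t \<Longrightarrow> cda_entry f t w (i' + j) = cda_entry f t w' (i' + j)"
  shows "w = w'"
proof -
  obtain y zs y' zs' where ww: "w = (y, zs)" "w' = (y', zs')" by (metis surj_pair)
  note r = cda_rowsD[OF w[unfolded ww]] cda_rowsD[OF w'[unfolded ww]]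
  \<comment> \<open>The letter of column \<open>i\<close> is chosen because this column lies to the
    left of the whole second window, even when the windows overlap. The column of the second window
    carrying the same letter is therefore in another block.\<close>
  let ?s = "i mod t"
  have s: "?s < t" using assms(2) by simp
  obtain j where j: "j < t" "(i' + j) mod t = ?s" using mod_shift_surj[OF s] .
  have blk: "(i' + j) div t < k" "i div t < k"
    using j(1) bound assms(2,5) by (intro column_block_less; auto)+
  have ne: "i div t \<noteq> (i' + j) div t"
  proof
    assume "i div t = (i' + j) div t"
    then have "i = i' + j" using j(2) by (metis div_mult_mod_eq)
    with assms(5) show False by simp
  qed
  have "f (i div t) (zs ! ?s) y = f (i div t) (zs' ! ?s) y'"
    using eq[of 0] assms(2) by (simp add: cda_entry_def ww)
  moreover have "f ((i' + j) div t) (zs ! ?s) y = f ((i' + j) div t) (zs' ! ?s) y'"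
    using eq'[OF j(1)] j(2) by (simp add: cda_entry_def ww)
  moreover have "y < v" "y' < v" using r assms(3) by auto
  ultimately have y: "y = y'"
    using orthogonal_familyD(3)[OF f blk(2,1) ne r(3)[OF s] _ r(6)[OF s]] by blast
  have "zs ! s = zs' ! s" if "s < t" for s
  proof -
    obtain j where j: "j < t" "(i + j) mod t = s" using mod_shift_surj[OF \<open>s < t\<close>] .
    have blk: "(i + j) div t < k"
      using j(1) bound assms(2,5) by (intro column_block_less) auto
    have "f ((i + j) div t) (zs ! s) y = f ((i + j) div t) (zs' ! s) y"
      using eq[OF j(1)] j(2) by (simp add: cda_entry_def ww y)
    moreover have "inj_on (\<lambda>x. f ((i + j) div t) x y) {..<v}"
      using orthogonal_familyD(2)[OF f blk \<open>y < v\<close>] .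
    ultimately show ?thesis using r(3)[OF that] r(6)[OF that] by (auto dest: inj_onD)
  qed
  then have "zs = zs'" using r by (intro nth_equalityI) auto
  then show ?thesis using y ww by simp
qed

lemma optimum_CDA_exists_if_orthogonal_family:
  assumes f: "orthogonal_family v k f" and "t > 0" "d > 0" "d < v" "k > 0"
  shows "optimum_CDA_exists d t (k + t - 1) v"
proof -
  define N where "N = (d + 1) * v ^ t"
  let ?C = "consec_interactions (k + t - 1) t v"
  obtain \<phi> where \<phi>: "bij_betw \<phi> {..<N} (cda_rows d t v)"
    using ex_bij_betw_nat_finite[OF finite_cda_rows] card_cda_rows
    by (metis N_def atLeast0LessThan)
  define A where "A r c = cda_entry f t (\<phi> r) c" for r c
  have \<phi>_row: "\<phi> r \<in> cda_rows d t v" if "r < N" for r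
    using \<phi> that by (metis bij_betwE lessThan_iff)
  have arr: "is_array N (k + t - 1) v A"
    unfolding is_array_def
  proof (intro allI impI)
    fix r c assume r: "r < N" and c: "c < k + t - 1"
    obtain y zs where yz: "\<phi> r = (y, zs)" by (metis surj_pair)
    note R = cda_rowsD[OF \<phi>_row[OF r, unfolded yz]]
    have "c mod t < t" "c div t < k" using c assms(2,5) column_block_less by auto
    then have "f (c div t) (zs ! (c mod t)) y < v"
      using R assms(4) by (intro orthogonal_familyD(1)[OF f]) auto
    then show "A r c < v"
      by (simp add: A_def cda_entry_def yz)
  qed
  have rhoD: "r < N" "j < t \<Longrightarrow> A r (i + j) = xs ! j"
    if "r \<in> rho N A (i, xs)" "(i, xs) \<in> ?C" for r i xs j
    using that by (auto simp: rho_def consec_interactions_def)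
  \<comment> \<open>Projecting the rows of \<open>T\<close> to their component \<open>y\<close> hits
    all \<open>d + 1\<close> values in \<open>{..d}\<close>; \<open>d < v\<close> makes these values
    legitimate symbols.\<close>
  have card_rho: "d + 1 \<le> card (rho N A T)" if "T \<in> ?C" for T
  proof -
    obtain i xs where T: "T = (i, xs)" by (metis surj_pair)
    have "\<exists>r\<in>rho N A T. y = fst (\<phi> r)" if y: "y \<le> d" for y
    proof -
      obtain zs where zs: "(y, zs) \<in> cda_rows d t v"
        "\<And>j. j < t \<Longrightarrow> cda_entry f t (y, zs) (i + j) = xs ! j"
        using cda_row_covering[OF f assms(2,4) \<open>T \<in> ?C\<close>[unfolded T] y] by metis
      have "(y, zs) \<in> \<phi> ` {..<N}" using zs(1) bij_betw_imp_surj_on[OF \<phi>] by simp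
      then obtain r where r: "r < N" "\<phi> r = (y, zs)" by auto
      have "r \<in> rho N A T"
        using r zs(2) \<open>T \<in> ?C\<close> by (simp add: rho_def T A_def consec_interactions_def)
      with r(2) show ?thesis by force
    qed
    then have "{..d} \<subseteq> (\<lambda>r. fst (\<phi> r)) ` rho N A T" by (auto simp: image_iff)
    then have "card {..d} \<le> card (rho N A T)" by (intro surj_card_le) (simp_all add: rho_def)
    then show ?thesis by simp
  qed
  have unique: "r = r'" if "T \<in> ?C" "T' \<in> ?C" "T \<noteq> T'"
    and r: "r \<in> rho N A T" "r \<in> rho N A T'" and r': "r' \<in> rho N A T" "r' \<in> rho N A T'"
    for r r' T T'
  proof -
    have main: "r = r'" if "(i, xs) \<in> ?C" "(i', xs') \<in> ?C" "i < i'"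
      and r: "r \<in> rho N A (i, xs)" "r \<in> rho N A (i', xs')"
      and r': "r' \<in> rho N A (i, xs)" "r' \<in> rho N A (i', xs')"
      for i xs i' xs'
    proof -
      have lt: "r < N" "r' < N" using rhoD(1) that by blast+
      have "\<phi> r = \<phi> r'"
      proof (rule cda_row_unique[OF f assms(2,4) _ \<open>i < i'\<close>])
        show "i' + t \<le> k + t - 1" using that(2) by (simp add: consec_interactions_def)
        show "\<phi> r \<in> cda_rows d t v" "\<phi> r' \<in> cda_rows d t v" using lt \<phi>_row by auto
        show "cda_entry f t (\<phi> r) (i + j) = cda_entry f t (\<phi> r') (i + j)" if "j < t" for j
          using rhoD(2)[OF r(1) \<open>(i, xs) \<in> ?C\<close> that] rhoD(2)[OF r'(1) \<open>(i, xs) \<in> ?C\<close> that]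
          by (simp add: A_def)
        show "cda_entry f t (\<phi> r) (i' + j) = cda_entry f t (\<phi> r') (i' + j)" if "j < t" for j
          using rhoD(2)[OF r(2) \<open>(i', xs') \<in> ?C\<close> that] rhoD(2)[OF r'(2) \<open>(i', xs') \<in> ?C\<close> that]
          by (simp add: A_def)
      qed
      then show ?thesis using inj_onD[OF bij_betw_imp_inj_on[OF \<phi>]] lt by simp
    qed
    obtain i xs i' xs' where TT: "T = (i, xs)" "T' = (i', xs')" by (metis surj_pair)
    \<comment> \<open>A row containing two interactions with the same starting column forces their
      symbols to agree, so distinct interactions sharing a row start in different columns.\<close>
    have "xs = xs'" if "i = i'"
    proof (rule nth_equalityI)
      show "length xs = length xs'" using \<open>T \<in> ?C\<close> \<open>T' \<in> ?C\<close> by (simp add: TT consec_interactions_def)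
      show "xs ! j = xs' ! j" if "j < length xs" for j
        using that \<open>i = i'\<close> \<open>T \<in> ?C\<close> \<open>T' \<in> ?C\<close> rhoD(2)[of r i xs j] rhoD(2)[of r i' xs' j] r
        by (simp add: TT consec_interactions_def)
    qed
    then have "i \<noteq> i'" using \<open>T \<noteq> T'\<close> TT by auto
    then consider "i < i'" | "i' < i" by linarith
    then show ?thesis using main that unfolding TT by cases blast+
  qed
  have "T \<in> \<T>"
    if "\<T> \<subseteq> ?C" "card \<T> = d" "T \<in> ?C" and sub: "rho N A T \<subseteq> rho_set N A \<T>" for \<T> T
  proof (rule ccontr)
    assume notin: "T \<notin> \<T>"
    \<comment> \<open>An infinite set has \<open>card\<close> equal to \<open>0\<close>, so
      \<open>d > 0\<close> yields finiteness.\<close>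
    have fin: "finite \<T>" using that(2) assms(3) card_gt_0_iff by metis
    have "rho N A T = (\<Union>T'\<in>\<T>. rho N A T \<inter> rho N A T')"
      using sub by (auto simp: rho_set_def)
    then have "card (rho N A T) \<le> (\<Sum>T'\<in>\<T>. card (rho N A T \<inter> rho N A T'))"
      using card_UN_le[OF fin] by metis
    also have "\<dots> \<le> (\<Sum>T'\<in>\<T>. 1)"
    proof (rule sum_mono)
      fix T' assume "T' \<in> \<T>"
      then have "T' \<in> ?C" "T \<noteq> T'" using that(1) notin by auto
      then have "\<forall>r\<in>rho N A T \<inter> rho N A T'. \<forall>r'\<in>rho N A T \<inter> rho N A T'. r = r'"
        using unique[OF that(3)] by blast
      moreover have fin_rho: "finite (rho N A T \<inter> rho N A T')" by (simp add: rho_def)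
      ultimately show "card (rho N A T \<inter> rho N A T') \<le> 1"
        by (simp only: One_nat_def card_le_Suc0_iff_eq[OF fin_rho])
    qed
    also have "\<dots> = d" using that(2) by simp
    finally show False using card_rho[OF that(3)] by simp
  qed
  moreover have "rho N A T \<subseteq> rho_set N A \<T>" if "T \<in> \<T>" for \<T> T
    using that by (auto simp: rho_set_def)
  moreover have "rho N A T \<noteq> {}" if "T \<in> ?C" for T
    using card_rho[OF that] by force
  ultimately have "is_CDA d t N (k + t - 1) v A"
    unfolding is_CDA_def using arr by (intro conjI ballI allI impI iffI) simp_all
  then show ?thesis
    unfolding optimum_CDA_exists_def N_def by auto
qed

theorem mainTheorem10:
  fixes v t d :: nat
  assumes "v \<ge> 2"
    and "t > 0" and "d > 0"
    and "\<forall>p\<in>prime_factors v. p ^ multiplicity p v > t + 1"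
    and "d + 1 \<le> v"
  shows "optimum_CDA_exists d t
           (Min ((\<lambda>p. p ^ multiplicity p v) ` prime_factors v) + t - 1) v"
proof -
  let ?q = "\<lambda>p. p ^ multiplicity p v"
  define k where "k = Min (?q ` prime_factors v)"
  have pf: "p ^ multiplicity p v > 0" "multiplicity p v > 0" "Factorial_Ring.prime p"
    if "p \<in> prime_factors v" for p
    using that by (auto simp: prime_factors_multiplicity prime_gt_0_nat)
  have k_le: "k \<le> ?q p" if "p \<in> prime_factors v" for p
    using that unfolding k_def by (intro Min_le) auto
  \<comment> \<open>From \<open>v \<ge> 2\<close> the minimum is taken over a nonempty set, hence is
    itself one of the prime powers and positive.\<close>
  have "prime_factors v \<noteq> {}"
    using assms(1) prime_factorization_empty_iff[of v] by auto
  then have "k \<in> ?q ` prime_factors v" unfolding k_def by (intro Min_in) auto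
  then have k_pos: "k > 0" using pf(1) by auto
  have "\<exists>f. orthogonal_family (?q p) k f" if p: "p \<in> prime_factors v" for p
  proof -
    obtain F :: "((int list \<times> nat) multiset \<Rightarrow> int) ring"
      where "field F" "card (carrier F) = ?q p"
      using finite_field_exists[OF pf(3,2)[OF p]] by blast
    then show ?thesis
      using orthogonal_family_if_field[OF _ _ pf(1)[OF p]] orthogonal_family_mono k_le[OF p] by blast
  qed
  then obtain f where "orthogonal_family (\<Prod>p\<in>prime_factors v. ?q p) k f"
    using orthogonal_family_prod_set[of "prime_factors v" ?q k] by blast
  moreover have "(\<Prod>p\<in>prime_factors v. ?q p) = v"
    using prime_factorization_nat[of v] assms(1) by simp
  ultimately have "orthogonal_family v k f" by simp
  then show ?thesis
    unfolding k_def[symmetric]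
    by (rule optimum_CDA_exists_if_orthogonal_family) (use assms k_pos in auto)
qed

end
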